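(* Let $y\in\mathbb{S}^2$, and let $A,B\in\mathbb{S}^2$ be sufficiently close to $y$. Put $U=\operatorname{Log}_y(A)$, $W=\operatorname{Log}_y(B)$. For $\lambda$ in a fixed bounded interval, $$\operatorname{Log}_y\!\left(\operatorname{SLERP}(A,B,\lambda)\right)=(1-\lambda)U+\lambda W+\mathcal{C}_\lambda(U,W)+O(\rho^5),$$ where $\rho=|U|+|W|$, $Z=(1-\lambda)U+\lambda W$, and $$\mathcal{C}_\lambda(U,W)=\frac16\Big\{|Z|^2Z+(1-\lambda)\lambda(2-\lambda)|U-W|^2U+\lambda(1-\lambda^2)|U-W|^2W-(1-\lambda)|U|^2U-\lambda|W|^2W\Big\}.$$ In particular, the first non-affine correction is cubic in the endpoint coordinates.
   Context: $\mathbb{S}^2=\{x\in\mathbb{R}^3:|x|=1\}$ with the induced Riemannian metric; $T_y\mathbb{S}^2=\{v\in\mathbb{R}^3:v\cdot y=0\}$. $\operatorname{Exp}_y(v)=\cos|v|\,y+\frac{\sin|v|}{|v|}v$ for $v\in T_y\mathbb{S}^2$ (with $\operatorname{Exp}_y(0)=y$). For $z$ not antipodal to $y$ and $\alpha=\arccos(y\cdot z)$, $\operatorname{Log}_y(z)=\frac{\alpha}{\sin\alpha}(z-(y\cdot z)y)\in T_y\mathbb{S}^2$ (with $\operatorname{Log}_y(y)=0$). For non-antipodal $a,b\in\mathbb{S}^2$ and any real $\lambda$, $\operatorname{SLERP}(a,b,\lambda)=\operatorname{Exp}_a(\lambda\operatorname{Log}_a b)$, equivalently $\frac{\sin((1-\lambda)\alpha)}{\sin\alpha}a+\frac{\sin(\lambda\alpha)}{\sin\alpha}b$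 with $\alpha=\arccos(a\cdot b)\in(0,\pi)$. The $O(\rho^5)$ term is bounded in norm by $C\rho^5$ for all sufficiently small $\rho$, with $C$ uniform for $\lambda$ in the bounded interval. *)

theory Defs
  imports "HOL-Analysis.Analysis"
begin

definition tangent_space :: "real^3 \<Rightarrow> (real^3) set" where
  "tangent_space y = {v. v \<bullet> y = 0}"

definition Exp_sphere :: "real^3 \<Rightarrow> real^3 \<Rightarrow> real^3" where
  "Exp_sphere y v =
     (if v = 0 then y else cos (norm v) *\<^sub>R y + (sin (norm v) / norm v) *\<^sub>R v)"

text \<open>Meaningful only for unit vectors with \<open>z \<noteq> - y\<close>; at the antipode the total function
  returns the junk value 0.\<close>

definition Log_sphere :: "real^3 \<Rightarrow> real^3 \<Rightarrow> real^3" where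
  "Log_sphere y z =
     (if z = y then 0
      else (arccos (y \<bullet> z) / sin (arccos (y \<bullet> z))) *\<^sub>R (z - (y \<bullet> z) *\<^sub>R y))"

definition slerp :: "real^3 \<Rightarrow> real^3 \<Rightarrow> real \<Rightarrow> real^3" where
  "slerp a b t = Exp_sphere a (t *\<^sub>R Log_sphere a b)"

definition slerp_correction :: "real \<Rightarrow> real^3 \<Rightarrow> real^3 \<Rightarrow> real^3" where
  "slerp_correction t U W =
     (let Z = (1 - t) *\<^sub>R U + t *\<^sub>R W in
      (1/6) *\<^sub>R
        ((norm Z)\<^sup>2 *\<^sub>R Z
         + ((1 - t) * t * (2 - t) * (norm (U - W))\<^sup>2) *\<^sub>R U
         + (t * (1 - t\<^sup>2) * (norm (U - W))\<^sup>2) *\<^sub>R W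
         - ((1 - t) * (norm U)\<^sup>2) *\<^sub>R U
         - (t * (norm W)\<^sup>2) *\<^sub>R W))"

text \<open>A homogeneous polynomial map of degree 3, in coordinate-free form: the restriction of a
  trilinear map to the diagonal.\<close>

definition homogeneous_cubic :: "('a::real_vector \<Rightarrow> 'b::real_vector) \<Rightarrow> bool" where
  "homogeneous_cubic f \<longleftrightarrow>
     (\<exists>M. (\<forall>q r. linear (\<lambda>p. M p q r)) \<and>
          (\<forall>p r. linear (\<lambda>q. M p q r)) \<and>
          (\<forall>p q. linear (\<lambda>r. M p q r)) \<and>
          (\<forall>p. f p = M p p p))"

end

(* Write A = cos|U| y + sinc|U| U, and similarly for B. Then SLERP(A,B,t) is a combination of A
   and B with coefficients s sinc(s a) / sinc a for s = 1 - t and s = t, where a is the angle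
   between A and B, so its component orthogonal to y is P = p U + q W for explicit scalars p, q,
   and its logarithm is P r / sin r with sin r = |P|. Only scalar functions have to be expanded:
   a^2 = |U - W|^2 + O(rho^4) and r^2 = |P|^2 + O(rho^4) = |Z|^2 + O(rho^4), so every coefficient
   of U and W is known modulo O(rho^4). Uniformity in t comes for free by working along a filter
   on the triples (A, B, t) for which A and B tend to y and t stays bounded. *)

theory Submission
  imports Defs "HOL-Real_Asymp.Real_Asymp"
begin

section \<open>The function sin x / x and scalar expansions at 0\<close>

text \<open>Avoids case distinctions at coinciding points: \<open>Exp_sphere\<close>,
  \<open>Log_sphere\<close> and the interpolation weights become single formulas in it.\<close>

definition sinc :: "real \<Rightarrow> real" where
  "sinc x = (if x = 0 then 1 else sin x / x)"

lemma sinc_0 [simp]: "sinc 0 = 1"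
  by (simp add: sinc_def)

lemma mult_sinc: "x * sinc x = sin x"
  by (simp add: sinc_def)

lemma sinc_abs [simp]: "sinc \<bar>x\<bar> = sinc x"
  by (simp add: sinc_def abs_if)

lemma abs_sinc_le_1: "\<bar>sinc x\<bar> \<le> 1"
  using abs_sin_x_le_abs_x[of x] by (simp add: sinc_def divide_le_eq)

lemma sinc_pos: "0 \<le> x \<Longrightarrow> x < pi \<Longrightarrow> 0 < sinc x"
  by (auto simp: sinc_def sin_gt_zero)

text \<open>\<open>real_asymp\<close> proves bounds on the punctured filter \<open>at 0\<close>, but
  arguments such as \<open>norm (U x)\<close> may be 0 along the limit. At 0 itself the bound is
  trivial because \<open>f 0 = 0\<close>.\<close>

lemma bigo_nhds_from_at:
  fixes f g :: "real \<Rightarrow> real"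
  assumes "f \<in> O[at 0](g)" and "f 0 = 0"
  shows "f \<in> O[nhds 0](g)"
proof -
  from assms(1) obtain c where "c > 0" "\<forall>\<^sub>F x in at 0. norm (f x) \<le> c * norm (g x)"
    by (elim landau_o.bigE)
  then show ?thesis using assms(2)
    by (intro landau_o.bigI[of c]) (auto simp: eventually_nhds_conv_at)
qed

lemma eventually_sinc_at_0: "\<forall>\<^sub>F x in at 0. sinc x = sin x / x"
  by (auto simp: eventually_at_filter sinc_def)

lemma sinc_minus_1_bigo: "(\<lambda>x. sinc x - 1) \<in> O[nhds 0](\<lambda>x. x\<^sup>2)"
proof (rule bigo_nhds_from_at)
  have "(\<lambda>x::real. sin x / x - 1) \<in> O[at 0](\<lambda>x. x\<^sup>2)"
    by real_asymp
  then show "(\<lambda>x. sinc x - 1) \<in> O[at 0](\<lambda>x. x\<^sup>2)"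
    by (rule landau_o.big.in_cong[THEN iffD2, rotated])
       (use eventually_sinc_at_0 in eventually_elim, simp)
qed simp

lemma sinc_expansion: "(\<lambda>x. sinc x - (1 - x\<^sup>2 / 6)) \<in> O[nhds 0](\<lambda>x. x ^ 4)"
proof (rule bigo_nhds_from_at)
  have "(\<lambda>x::real. sin x / x - (1 - x\<^sup>2 / 6)) \<in> O[at 0](\<lambda>x. x ^ 4)"
    by real_asymp
  then show "(\<lambda>x. sinc x - (1 - x\<^sup>2 / 6)) \<in> O[at 0](\<lambda>x. x ^ 4)"
    by (rule landau_o.big.in_cong[THEN iffD2, rotated])
       (use eventually_sinc_at_0 in eventually_elim, simp)
qed simp

lemma inverse_sinc_expansion:
  "(\<lambda>x. 1 / sinc x - (1 + x\<^sup>2 / 6)) \<in> O[nhds 0](\<lambda>x. x ^ 4)"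
proof (rule bigo_nhds_from_at)
  have "(\<lambda>x::real. 1 / (sin x / x) - (1 + x\<^sup>2 / 6)) \<in> O[at 0](\<lambda>x. x ^ 4)"
    by real_asymp
  then show "(\<lambda>x. 1 / sinc x - (1 + x\<^sup>2 / 6)) \<in> O[at 0](\<lambda>x. x ^ 4)"
    by (rule landau_o.big.in_cong[THEN iffD2, rotated])
       (use eventually_sinc_at_0 in eventually_elim, simp)
qed simp

lemma cos_expansion: "(\<lambda>x::real. cos x - (1 - x\<^sup>2 / 2)) \<in> O[nhds 0](\<lambda>x. x ^ 4)"
  by (rule bigo_nhds_from_at, real_asymp, simp)

lemma sin_squared_expansion: "(\<lambda>x::real. (sin x)\<^sup>2 - x\<^sup>2) \<in> O[nhds 0](\<lambda>x. x ^ 4)"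
  by (rule bigo_nhds_from_at, real_asymp, simp)

text \<open>Used in reverse: a bound on 1 - cos \<alpha> yields one on \<alpha>^2.
  \<open>square_bigo_sin\<close> does the same for r.\<close>

lemma square_bigo_cos: "(\<lambda>x::real. x\<^sup>2) \<in> O[nhds 0](\<lambda>x. 1 - cos x)"
  by (rule bigo_nhds_from_at, real_asymp, simp)

lemma square_bigo_sin: "(\<lambda>x::real. x\<^sup>2) \<in> O[nhds 0](\<lambda>x. (sin x)\<^sup>2)"
  by (rule bigo_nhds_from_at, real_asymp, simp)

text \<open>The difference splits as (f - g) f' + g (f' - g'), hence the boundedness of f' and
  g.\<close>

lemma bigo_mult_diff:
  fixes f g f' g' :: "'a \<Rightarrow> real"
  assumes "(\<lambda>x. f x - g x) \<in> O[F](h)" "(\<lambda>x. f' x - g' x) \<in> O[F](h)"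
    and "f' \<in> O[F](\<lambda>_. 1)" "g \<in> O[F](\<lambda>_. 1)"
  shows "(\<lambda>x. f x * f' x - g x * g' x) \<in> O[F](h)"
proof -
  have "(\<lambda>x. (f x - g x) * f' x) \<in> O[F](h)" "(\<lambda>x. g x * (f' x - g' x)) \<in> O[F](h)"
    using landau_o.big.mult[OF assms(1,3)] landau_o.big.mult[OF assms(4,2)] by simp_all
  from sum_in_bigo(1)[OF this] show ?thesis
    by (simp add: algebra_simps)
qed

section \<open>Exponential and logarithm on the unit sphere\<close>

lemma Exp_sphere_sinc: "Exp_sphere y v = cos (norm v) *\<^sub>R y + sinc (norm v) *\<^sub>R v"
  by (simp add: Exp_sphere_def sinc_def)

text \<open>Pythagoras for the orthogonal vectors y and v, followed by cos^2 + sin^2 = 1.\<close>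

lemma norm_Exp_sphere:
  assumes "norm y = 1" "v \<bullet> y = 0"
  shows "norm (Exp_sphere y v) = 1"
proof -
  have "(norm (Exp_sphere y v))\<^sup>2 = (cos (norm v))\<^sup>2 + (norm v * sinc (norm v))\<^sup>2"
    using assms unfolding Exp_sphere_sinc
    by (simp add: power2_norm_eq_inner inner_simps inner_commute power_mult_distrib
        flip: norm_eq_1) (simp add: power2_eq_square norm_eq_1)
  then have "(norm (Exp_sphere y v))\<^sup>2 = 1"
    by (simp add: mult_sinc)
  then show ?thesis
    by (simp add: power2_eq_1_iff) (smt (verit) norm_ge_zero)
qed

lemma inner_unit_bounds:
  assumes "norm y = 1" "norm z = 1"
  shows "- 1 \<le> y \<bullet> z" "y \<bullet> z \<le> 1"
  using Cauchy_Schwarz_ineq2[of y z] assms by auto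

lemma inner_unit_eq_1_iff:
  assumes "norm y = 1" "norm z = 1"
  shows "y \<bullet> z = 1 \<longleftrightarrow> z = y"
  using norm_cauchy_schwarz_eq[of y z] assms by auto

lemma inner_unit_eq_minus_1_iff:
  assumes "norm y = 1" "norm z = 1"
  shows "y \<bullet> z = - 1 \<longleftrightarrow> z = - y"
  using inner_unit_eq_1_iff[of "- y" z] assms by auto

lemma arccos_inner_less_pi:
  assumes "norm y = 1" "norm z = 1" "z \<noteq> - y"
  shows "arccos (y \<bullet> z) < pi"
proof -
  have "-1 < y \<bullet> z"
    using inner_unit_bounds[of y z] inner_unit_eq_minus_1_iff[of y z] assms by force
  then show ?thesis
    using arccos_less_arccos[of "-1" "y \<bullet> z"] inner_unit_bounds[of y z] assms by simp
qed

text \<open>For z = y the tangential part vanishes, matching the separate case in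
  \<open>Log_sphere\<close>. At z = - y both sides are 0, the value of a division by 0.\<close>

lemma Log_sphere_sinc:
  assumes "norm y = 1" "norm z = 1"
  shows "Log_sphere y z = (1 / sinc (arccos (y \<bullet> z))) *\<^sub>R (z - (y \<bullet> z) *\<^sub>R y)"
proof (cases "z = y")
  case True
  then show ?thesis using assms by (simp add: Log_sphere_def dot_square_norm)
next
  case False
  then have "arccos (y \<bullet> z) \<noteq> 0"
    using inner_unit_eq_1_iff[OF assms] inner_unit_bounds[OF assms] arccos_eq_0_iff by simp
  then show ?thesis using False by (simp add: Log_sphere_def sinc_def)
qed

lemma norm_tangential_part:
  assumes "norm y = 1" "norm z = 1"
  shows "norm (z - (y \<bullet> z) *\<^sub>R y) = sin (arccos (y \<bullet> z))"
proof -
  have "y \<bullet> y = 1" "z \<bullet> z = 1"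
    using assms by (simp_all add: norm_eq_1)
  then have "(norm (z - (y \<bullet> z) *\<^sub>R y))\<^sup>2 = 1 - (y \<bullet> z)\<^sup>2"
    unfolding power2_norm_eq_inner
    by (simp add: inner_simps inner_commute power2_eq_square)
  then show ?thesis
    using inner_unit_bounds[OF assms] by (metis norm_ge_zero real_sqrt_unique sin_arccos)
qed

text \<open>With \<alpha> the angle from y to z, the tangential part has length sin \<alpha>, and
  sin \<alpha> / sinc \<alpha> = \<alpha>. Excluding the antipode keeps \<alpha> below pi and the
  divisor positive.\<close>

lemma norm_Log_sphere:
  assumes "norm y = 1" "norm z = 1" "z \<noteq> - y"
  shows "norm (Log_sphere y z) = arccos (y \<bullet> z)"
proof -
  let ?a = "arccos (y \<bullet> z)"
  have "0 \<le> ?a" "sinc ?a > 0"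
    using arccos_inner_less_pi[OF assms] inner_unit_bounds[OF assms(1,2)]
    by (auto intro!: sinc_pos arccos_lbound)
  then show ?thesis
    using mult_sinc[of ?a]
    unfolding Log_sphere_sinc[OF assms(1,2)] norm_scaleR norm_tangential_part[OF assms(1,2)]
    by (simp add: field_simps)
qed

lemma Log_sphere_tangent:
  assumes "norm y = 1" "norm z = 1"
  shows "Log_sphere y z \<bullet> y = 0" "y \<bullet> Log_sphere y z = 0"
  using assms
  by (simp_all add: Log_sphere_sinc inner_simps inner_commute dot_square_norm)

text \<open>This is Exp_y (Log_y z) = z written out; it supplies the coordinates of both endpoints
  around y.\<close>

lemma unit_eq_Log_sphere:
  assumes "norm y = 1" "norm z = 1" "z \<noteq> - y"
  shows "z = cos (norm (Log_sphere y z)) *\<^sub>R y + sinc (norm (Log_sphere y z)) *\<^sub>R Log_sphere y z"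
proof -
  have "sinc (arccos (y \<bullet> z)) > 0"
    using arccos_inner_less_pi[OF assms] inner_unit_bounds[OF assms(1,2)]
    by (auto intro!: sinc_pos arccos_lbound)
  then show ?thesis
    using inner_unit_bounds[OF assms(1,2)]
    by (simp add: norm_Log_sphere[OF assms]) (simp add: Log_sphere_sinc assms)
qed

section \<open>Spherical interpolation as a linear combination of the endpoints\<close>

lemma norm_slerp:
  assumes "norm a = 1" "norm b = 1"
  shows "norm (slerp a b s) = 1"
  unfolding slerp_def using assms by (intro norm_Exp_sphere) (auto simp: Log_sphere_tangent)

text \<open>The quotient $\sin(s\alpha)/\sin\alpha$, with its limit $s$ at $\alpha = 0$.\<close>

definition slerp_coeff :: "real \<Rightarrow> real \<Rightarrow> real" where
  "slerp_coeff s a = s * sinc (s * a) / sinc a"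

text \<open>Expanding Exp_a (s Log_a b) leaves the factor cos (s c) - sin (s c) cos c / sin c in
  front of a, which the subtraction formula for sin turns into sin ((1 - s) c) / sin c.\<close>

lemma slerp_eq:
  assumes "norm a = 1" "norm b = 1" "b \<noteq> - a"
  shows "slerp a b s = slerp_coeff (1 - s) (arccos (a \<bullet> b)) *\<^sub>R a
    + slerp_coeff s (arccos (a \<bullet> b)) *\<^sub>R b"
proof -
  define c where "c = arccos (a \<bullet> b)"
  have c: "0 \<le> c" "sinc c > 0" "cos c = a \<bullet> b"
    using arccos_inner_less_pi[OF assms] inner_unit_bounds[OF assms(1,2)]
    by (auto simp: c_def intro!: sinc_pos arccos_lbound)
  \<comment> \<open>The subtraction formula for sin, divided by c; at c = 0 it reads 1 = (1 - s) +
    s.\<close>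
  have "cos (s * c) * sinc c = (1 - s) * sinc ((1 - s) * c) + s * sinc (s * c) * cos c"
  proof (cases "c = 0")
    case False
    have "c * (cos (s * c) * sinc c) = cos (s * c) * sin c"
      by (metis mult.left_commute mult_sinc)
    also have "\<dots> = sin ((1 - s) * c) + sin (s * c) * cos c"
      by (simp add: left_diff_distrib sin_diff)
    also have "\<dots> = c * ((1 - s) * sinc ((1 - s) * c) + s * sinc (s * c) * cos c)"
      by (simp add: algebra_simps flip: mult_sinc)
    finally show ?thesis using False by simp
  qed simp
  then have eq: "cos (s * c) - s * sinc (s * c) / sinc c * cos c = slerp_coeff (1 - s) c"
    using c(2) by (simp add: slerp_coeff_def field_simps)
  \<comment> \<open>\<open>s\<close> may be negative, so the length of the scaled logarithm is |s|
    c; both functions are even.\<close>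
  have cos_abs: "cos (\<bar>s\<bar> * c) = cos (s * c)" and sinc_abs: "sinc (\<bar>s\<bar> * c) = sinc (s * c)"
    using c(1) cos_abs_real[of "s * c"] sinc_abs[of "s * c"] by (simp_all add: abs_mult)
  have "slerp a b s = cos (s * c) *\<^sub>R a
      + (s * sinc (s * c) / sinc c) *\<^sub>R (b - cos c *\<^sub>R a)"
    by (simp add: slerp_def Exp_sphere_sinc norm_Log_sphere[OF assms] cos_abs sinc_abs
        flip: c_def) (simp add: Log_sphere_sinc[OF assms(1,2)] c(3) flip: c_def)
  also have "\<dots> = slerp_coeff (1 - s) c *\<^sub>R a + slerp_coeff s c *\<^sub>R b"
    unfolding eq[symmetric] by (simp add: slerp_coeff_def algebra_simps)
  finally show ?thesis by (simp add: c_def)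
qed


section \<open>Angles and antipodality near the base point\<close>

text \<open>Continuity of \<open>arccos\<close> is used on [-1, 1], of which 1 is an end point,
  hence the second hypothesis.\<close>

lemma tendsto_arccos_at_1:
  assumes "(f \<longlongrightarrow> 1) F" "\<forall>\<^sub>F x in F. f x \<in> {-1..1}"
  shows "((\<lambda>x. arccos (f x)) \<longlongrightarrow> 0) F"
  using continuous_on_tendsto_compose[OF continuous_on_arccos' assms(1) _ assms(2)] by simp

lemma tendsto_arccos_inner:
  assumes "norm y = 1" "\<forall>\<^sub>F x in F. norm (f x) = 1" "\<forall>\<^sub>F x in F. norm (g x) = 1"
    and "(f \<longlongrightarrow> y) F" "(g \<longlongrightarrow> y) F"
  shows "((\<lambda>x. arccos (f x \<bullet> g x)) \<longlongrightarrow> 0) F"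
proof (rule tendsto_arccos_at_1)
  show "((\<lambda>x. f x \<bullet> g x) \<longlongrightarrow> 1) F"
    using tendsto_inner[OF assms(4,5)] assms(1) by (simp add: dot_square_norm)
  show "\<forall>\<^sub>F x in F. f x \<bullet> g x \<in> {-1..1}"
    using assms(2,3) by eventually_elim (simp add: inner_unit_bounds)
qed

text \<open>The sum of the two functions tends to 2 y, which is nonzero.\<close>

lemma eventually_not_antipodal:
  assumes "norm y = 1" "(f \<longlongrightarrow> y) F" "(g \<longlongrightarrow> y) F"
  shows "\<forall>\<^sub>F x in F. g x \<noteq> - f x"
proof -
  have "((\<lambda>x. f x + g x) \<longlongrightarrow> y + y) F"
    by (intro tendsto_add assms)
  moreover have "y + y \<noteq> 0"
    using assms(1) by (metis norm_zero scaleR_2 scaleR_eq_0_iff zero_neq_numeral zero_neq_one)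
  ultimately have "\<forall>\<^sub>F x in F. f x + g x \<noteq> 0"
    by (rule tendsto_imp_eventually_ne)
  then show ?thesis by eventually_elim (auto simp: add_eq_0_iff)
qed

section \<open>Orders of magnitude along a filter\<close>

text \<open>The filter is left abstract and \<open>t\<close> is only bounded, not convergent. The
  theorem instantiates \<open>A\<close>, \<open>B\<close> and \<open>t\<close> by the projections of
  a filter on triples, so that one constant serves all parameters near the limit.\<close>

locale slerp_limit =
  fixes F :: "'x filter" and y :: "real^3" and A B :: "'x \<Rightarrow> real^3" and t :: "'x \<Rightarrow> real"
  assumes norm_y: "norm y = 1"
    and unit_A: "\<forall>\<^sub>F x in F. norm (A x) = 1" and unit_B: "\<forall>\<^sub>F x in F. norm (B x) = 1"
    and lim_A: "(A \<longlongrightarrow> y) F" and lim_B: "(B \<longlongrightarrow> y) F"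
    and bounded_t: "t \<in> O[F](\<lambda>_. 1)"
begin

definition U :: "'x \<Rightarrow> real^3" where "U x = Log_sphere y (A x)"
definition W :: "'x \<Rightarrow> real^3" where "W x = Log_sphere y (B x)"
definition Z :: "'x \<Rightarrow> real^3" where "Z x = (1 - t x) *\<^sub>R U x + t x *\<^sub>R W x"
definition \<rho> :: "'x \<Rightarrow> real" where "\<rho> x = norm (U x) + norm (W x)"
definition \<alpha> :: "'x \<Rightarrow> real" where "\<alpha> x = arccos (A x \<bullet> B x)"
definition S :: "'x \<Rightarrow> real^3" where "S x = slerp (A x) (B x) (t x)"
text \<open>A filtration by order in \<rho>: \<open>R 0\<close> consists of the functions eventually
  bounded along \<open>F\<close>, and orders add under multiplication.\<close>

definition R :: "nat \<Rightarrow> ('x \<Rightarrow> real) set" where "R n = O[F](\<lambda>x. \<rho> x ^ n)"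

lemma rho_nonneg: "0 \<le> \<rho> x"
  by (simp add: \<rho>_def)

lemma tendsto_norm_U: "((\<lambda>x. norm (U x)) \<longlongrightarrow> 0) F"
proof (rule Lim_transform_eventually)
  show "((\<lambda>x. arccos (y \<bullet> A x)) \<longlongrightarrow> 0) F"
    using norm_y by (intro tendsto_arccos_inner[OF norm_y] unit_A lim_A tendsto_const) auto
  show "\<forall>\<^sub>F x in F. arccos (y \<bullet> A x) = norm (U x)"
    using unit_A eventually_not_antipodal[OF norm_y tendsto_const lim_A]
    by eventually_elim (simp add: U_def norm_Log_sphere norm_y)
qed

lemma tendsto_norm_W: "((\<lambda>x. norm (W x)) \<longlongrightarrow> 0) F"
proof (rule Lim_transform_eventually)
  show "((\<lambda>x. arccos (y \<bullet> B x)) \<longlongrightarrow> 0) F"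
    using norm_y by (intro tendsto_arccos_inner[OF norm_y] unit_B lim_B tendsto_const) auto
  show "\<forall>\<^sub>F x in F. arccos (y \<bullet> B x) = norm (W x)"
    using unit_B eventually_not_antipodal[OF norm_y tendsto_const lim_B]
    by eventually_elim (simp add: W_def norm_Log_sphere norm_y)
qed

lemma tendsto_rho: "(\<rho> \<longlongrightarrow> 0) F"
  using tendsto_add[OF tendsto_norm_U tendsto_norm_W] by (simp add: \<rho>_def[abs_def])

lemma tendsto_alpha: "(\<alpha> \<longlongrightarrow> 0) F"
  unfolding \<alpha>_def[abs_def]
  by (intro tendsto_arccos_inner[OF norm_y] unit_A unit_B lim_A lim_B)

lemma R_mono:
  assumes "f \<in> R m" "n \<le> m"
  shows "f \<in> R n"
proof -
  have "\<forall>\<^sub>F x in F. \<rho> x < 1"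
    using tendsto_rho by (rule order_tendstoD) simp
  then have "\<forall>\<^sub>F x in F. norm (\<rho> x ^ m) \<le> 1 * norm (\<rho> x ^ n)"
    by eventually_elim (use assms(2) rho_nonneg in \<open>auto intro: power_decreasing\<close>)
  then have "(\<lambda>x. \<rho> x ^ m) \<in> O[F](\<lambda>x. \<rho> x ^ n)"
    by (rule bigoI)
  then show ?thesis
    using assms(1) unfolding R_def by (rule landau_o.big_trans[rotated])
qed

lemma R_const: "(\<lambda>_. c) \<in> R 0"
  by (simp add: R_def)

lemma R_t: "t \<in> R 0"
  using bounded_t by (simp add: R_def)

lemma R_add: "f \<in> R n \<Longrightarrow> g \<in> R n \<Longrightarrow> (\<lambda>x. f x + g x) \<in> R n"
  unfolding R_def by (rule sum_in_bigo)

lemma R_diff: "f \<in> R n \<Longrightarrow> g \<in> R n \<Longrightarrow> (\<lambda>x. f x - g x) \<in> R n"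
  unfolding R_def by (rule sum_in_bigo)

lemma R_mult: "f \<in> R m \<Longrightarrow> g \<in> R n \<Longrightarrow> (\<lambda>x. f x * g x) \<in> R (m + n)"
  unfolding R_def power_add by (rule landau_o.big.mult)

lemma R_mult_left: "f \<in> R 0 \<Longrightarrow> g \<in> R n \<Longrightarrow> (\<lambda>x. f x * g x) \<in> R n"
  using R_mult[of f 0 g n] by simp

lemma R_power: "f \<in> R m \<Longrightarrow> (\<lambda>x. f x ^ n) \<in> R (m * n)"
  unfolding R_def power_mult by (rule landau_o.big_power)

lemma R_power_0: "f \<in> R 0 \<Longrightarrow> (\<lambda>x. f x ^ n) \<in> R 0"
  using R_power[of f 0 n] by simp

lemma R_trans:
  assumes "(\<lambda>x. f x - g x) \<in> R n" "(\<lambda>x. g x - h x) \<in> R n"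
  shows "(\<lambda>x. f x - h x) \<in> R n"
  using R_add[OF assms] by simp

lemma R_mult_diff:
  assumes "(\<lambda>x. f x - g x) \<in> R n" "(\<lambda>x. f' x - g' x) \<in> R n" "f' \<in> R 0" "g \<in> R 0"
  shows "(\<lambda>x. f x * f' x - g x * g' x) \<in> R n"
  using assms unfolding R_def by (intro bigo_mult_diff) simp_all

lemma R_transfer: "g \<in> R n \<Longrightarrow> \<forall>\<^sub>F x in F. f x = g x \<Longrightarrow> f \<in> R n"
  unfolding R_def by (subst landau_o.big.in_cong)

lemma R_tendsto_0:
  assumes "f \<in> R 1"
  shows "(f \<longlongrightarrow> 0) F"
proof -
  obtain c where "\<forall>\<^sub>F x in F. norm (f x) \<le> c * norm (\<rho> x)"
    using assms unfolding R_def by (auto elim: landau_o.bigE)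
  moreover have "((\<lambda>x. c * norm (\<rho> x)) \<longlongrightarrow> 0) F"
    using tendsto_mult_left[OF tendsto_norm[OF tendsto_rho], of c] by simp
  ultimately show ?thesis
    by (rule Lim_null_comparison)
qed

lemma R_of_norm_le:
  assumes "g \<in> R n" "\<And>x. \<bar>f x\<bar> \<le> g x"
  shows "f \<in> R n"
proof -
  have "f \<in> O[F](g)"
    by (rule landau_o.big_mono, rule always_eventually) (use assms(2) abs_ge_self in \<open>force intro: order_trans\<close>)
  then show ?thesis
    using assms(1) unfolding R_def by (rule landau_o.big_trans)
qed

text \<open>Carries a scalar expansion at 0 over to the filter by substituting a quantity that tends
  to 0.\<close>

lemma R_compose_power:
  assumes "f \<in> O[nhds 0](\<lambda>z. z ^ k)" "(v \<longlongrightarrow> 0) F" "(\<lambda>x. v x ^ k) \<in> R n"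
  shows "(\<lambda>x. f (v x)) \<in> R n"
  using landau_o.big.compose[OF assms(1,2)] assms(3) unfolding R_def
  by (rule landau_o.big_trans)

section \<open>Orders of the endpoint coordinates and of scalar functions of small arguments\<close>

lemma R_rho: "\<rho> \<in> R 1"
  by (simp add: R_def)

lemma R_U: "(\<lambda>x. norm (U x)) \<in> R 1" and R_W: "(\<lambda>x. norm (W x)) \<in> R 1"
  by (rule R_of_norm_le[OF R_rho], simp add: \<rho>_def)+

lemma R_inner_U_W: "(\<lambda>x. U x \<bullet> W x) \<in> R 2"
proof (rule R_of_norm_le)
  show "(\<lambda>x. norm (U x) * norm (W x)) \<in> R 2"
    using R_mult[OF R_U R_W] by (simp add: numeral_2_eq_2)
qed (rule Cauchy_Schwarz_ineq2)

lemma R_bounded_of_R: "f \<in> R n \<Longrightarrow> f \<in> R 0"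
  by (rule R_mono) auto

lemma R_bounded_of_diff: "(\<lambda>x. f x - g x) \<in> R n \<Longrightarrow> g \<in> R 0 \<Longrightarrow> f \<in> R 0"
  using R_add[of "\<lambda>x. f x - g x" 0 g] by (auto dest: R_bounded_of_R)

lemma R_norm_diff_squared: "(\<lambda>x. (norm (U x - W x))\<^sup>2) \<in> R 2"
proof -
  have "(\<lambda>x. norm (U x - W x)) \<in> R 1"
    by (rule R_of_norm_le[OF R_rho]) (simp add: \<rho>_def norm_triangle_ineq4)
  from R_power[OF this, of 2] show ?thesis by simp
qed

lemma norm_diff_squared:
  "(norm (U x - W x))\<^sup>2 = (norm (U x))\<^sup>2 + (norm (W x))\<^sup>2 - 2 * (U x \<bullet> W x)"
  by (simp add: power2_norm_eq_inner inner_simps inner_commute)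

lemma cos_diff_R:
  assumes "v \<in> R 1"
  shows "(\<lambda>x. cos (v x) - (1 - (v x)\<^sup>2 / 2)) \<in> R 4"
  using R_compose_power[OF cos_expansion R_tendsto_0[OF assms]] R_power[OF assms, of 4] by simp

lemma sinc_diff_R:
  assumes "v \<in> R 1"
  shows "(\<lambda>x. sinc (v x) - (1 - (v x)\<^sup>2 / 6)) \<in> R 4"
  using R_compose_power[OF sinc_expansion R_tendsto_0[OF assms]] R_power[OF assms, of 4] by simp

lemma sinc_minus_1_R:
  assumes "v \<in> R 1"
  shows "(\<lambda>x. sinc (v x) - 1) \<in> R 2"
  using R_compose_power[OF sinc_minus_1_bigo R_tendsto_0[OF assms]] R_power[OF assms, of 2] by simp

lemma inverse_sinc_diff_R:
  assumes "v \<in> R 1"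
  shows "(\<lambda>x. 1 / sinc (v x) - (1 + (v x)\<^sup>2 / 6)) \<in> R 4"
  using R_compose_power[OF inverse_sinc_expansion R_tendsto_0[OF assms]] R_power[OF assms, of 4] by simp

lemma bounded_cos: "(\<lambda>x. cos (v x)) \<in> R 0"
  by (rule R_of_norm_le[OF R_const[of 1]]) simp

lemma bounded_sinc: "(\<lambda>x. sinc (v x)) \<in> R 0"
  by (rule R_of_norm_le[OF R_const[of 1]]) (simp add: abs_sinc_le_1)

lemma bounded_quadratic:
  assumes "v \<in> R 1"
  shows "(\<lambda>x. 1 + (v x)\<^sup>2 / c) \<in> R 0" "(\<lambda>x. 1 - (v x)\<^sup>2 / c) \<in> R 0"
proof -
  have "(\<lambda>x. 1 / c * (v x)\<^sup>2) \<in> R 0"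
    using assms by (intro R_mult_left R_const R_power_0) (rule R_bounded_of_R)
  then show "(\<lambda>x. 1 + (v x)\<^sup>2 / c) \<in> R 0" "(\<lambda>x. 1 - (v x)\<^sup>2 / c) \<in> R 0"
    using R_add[OF R_const[of 1]] R_diff[OF R_const[of 1]] by force+
qed

text \<open>The angles \<alpha> and r are estimated through their squares, since 1 - cos \<alpha>
  and sin^2 r are what can be computed.\<close>

lemma R_sqrt:
  assumes "(\<lambda>x. (v x)\<^sup>2) \<in> R 2"
  shows "v \<in> R 1"
proof -
  obtain c where c: "c > 0" "\<forall>\<^sub>F x in F. norm ((v x)\<^sup>2) \<le> c * norm ((\<rho> x)\<^sup>2)"
    using assms unfolding R_def by (elim landau_o.bigE)
  from c(2) have "\<forall>\<^sub>F x in F. norm (v x) \<le> sqrt c * norm (\<rho> x)"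
  proof eventually_elim
    case (elim x)
    then have "sqrt ((v x)\<^sup>2) \<le> sqrt (c * (\<rho> x)\<^sup>2)" by (intro real_sqrt_le_mono) simp
    then show ?case by (simp add: real_sqrt_mult)
  qed
  then show ?thesis unfolding R_def by (simp add: bigoI)
qed

section \<open>The angle between the endpoints\<close>

text \<open>Collects the exact identities that hold once no two of A, B, y are antipodal; the later
  expansions start from them.\<close>

lemma representation:
  "\<forall>\<^sub>F x in F. A x = cos (norm (U x)) *\<^sub>R y + sinc (norm (U x)) *\<^sub>R U x \<and>
    B x = cos (norm (W x)) *\<^sub>R y + sinc (norm (W x)) *\<^sub>R W x \<and>
    U x \<bullet> y = 0 \<and> W x \<bullet> y = 0 \<and> \<bar>A x \<bullet> B x\<bar> \<le> 1 \<and>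
    S x = slerp_coeff (1 - t x) (\<alpha> x) *\<^sub>R A x + slerp_coeff (t x) (\<alpha> x) *\<^sub>R B x \<and>
    norm (S x) = 1"
  using unit_A unit_B eventually_not_antipodal[OF norm_y tendsto_const lim_A]
    eventually_not_antipodal[OF norm_y tendsto_const lim_B]
    eventually_not_antipodal[OF norm_y lim_A lim_B]
proof eventually_elim
  case (elim x)
  then show ?case
    using unit_eq_Log_sphere[OF norm_y] Log_sphere_tangent[OF norm_y] Cauchy_Schwarz_ineq2[of "A x" "B x"]
    by (simp add: U_def W_def S_def \<alpha>_def slerp_eq norm_slerp flip: slerp_eq)
qed

text \<open>Orthogonality to y gives A . B = cos u cos w + sinc u sinc w (U . W) with u = |U|, w =
  |W|. The quadratic terms -u^2/2 - w^2/2 + U . W form -|U - W|^2/2; all remaining ones have order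
  4.\<close>

lemma inner_A_B_expansion: "(\<lambda>x. A x \<bullet> B x - (1 - (norm (U x - W x))\<^sup>2 / 2)) \<in> R 4"
proof -
  let ?u = "\<lambda>x. norm (U x)" and ?w = "\<lambda>x. norm (W x)"
  have "(\<lambda>x. cos (?u x) * cos (?w x) - (1 - (?u x)\<^sup>2 / 2) * (1 - (?w x)\<^sup>2 / 2)) \<in> R 4"
    by (rule R_mult_diff[OF cos_diff_R[OF R_U] cos_diff_R[OF R_W] bounded_cos
          bounded_quadratic(2)[OF R_U]])
  \<comment> \<open>The cross term from multiplying the two truncated cosines.\<close>
  moreover have "(\<lambda>x. 1/4 * ((?u x)\<^sup>2 * (?w x)\<^sup>2)) \<in> R 4"
    using R_mult[OF R_power[OF R_U, of 2] R_power[OF R_W, of 2]]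
    by (intro R_mult_left[OF R_const]) simp
  moreover have "(\<lambda>x. (sinc (?u x) * sinc (?w x) - 1 * 1) * (U x \<bullet> W x)) \<in> R 4"
  proof -
    have "(\<lambda>x. sinc (?u x) * sinc (?w x) - 1 * 1) \<in> R 2"
      by (rule R_mult_diff[OF sinc_minus_1_R[OF R_U] sinc_minus_1_R[OF R_W] bounded_sinc R_const])
    from R_mult[OF this R_inner_U_W] show ?thesis by simp
  qed
  ultimately have "(\<lambda>x. (cos (?u x) * cos (?w x) - (1 - (?u x)\<^sup>2 / 2) * (1 - (?w x)\<^sup>2 / 2))
      + 1/4 * ((?u x)\<^sup>2 * (?w x)\<^sup>2) + (sinc (?u x) * sinc (?w x) - 1 * 1) * (U x \<bullet> W x)) \<in> R 4"
    by (intro R_add)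
  moreover have "\<forall>\<^sub>F x in F. A x \<bullet> B x - (1 - (norm (U x - W x))\<^sup>2 / 2)
    = (cos (?u x) * cos (?w x) - (1 - (?u x)\<^sup>2 / 2) * (1 - (?w x)\<^sup>2 / 2))
      + 1/4 * ((?u x)\<^sup>2 * (?w x)\<^sup>2) + (sinc (?u x) * sinc (?w x) - 1 * 1) * (U x \<bullet> W x)"
    using representation
  proof eventually_elim
    case (elim x)
    then have AB: "A x = cos (?u x) *\<^sub>R y + sinc (?u x) *\<^sub>R U x"
        "B x = cos (?w x) *\<^sub>R y + sinc (?w x) *\<^sub>R W x"
      and 0: "U x \<bullet> y = 0" "y \<bullet> W x = 0"
      by (auto simp: inner_commute)
    have "A x \<bullet> B x = cos (?u x) * cos (?w x) + sinc (?u x) * sinc (?w x) * (U x \<bullet> W x)"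
      using norm_y 0 by (subst AB(1), subst AB(2)) (simp add: inner_simps dot_square_norm)
    then show ?case
      unfolding norm_diff_squared by (simp add: field_simps)
  qed
  ultimately show ?thesis by (rule R_transfer)
qed

lemma cos_alpha: "\<forall>\<^sub>F x in F. cos (\<alpha> x) = A x \<bullet> B x"
  using representation by eventually_elim (auto simp: \<alpha>_def abs_le_iff)

text \<open>\<alpha>^2 is O(1 - cos \<alpha>), and 1 - cos \<alpha> = 1 - A . B has order 2 by the
  expansion above.\<close>

lemma R_alpha: "\<alpha> \<in> R 1"
proof (rule R_sqrt)
  have "(\<lambda>x. 1/2 * (norm (U x - W x))\<^sup>2 - (A x \<bullet> B x - (1 - (norm (U x - W x))\<^sup>2 / 2))) \<in> R 2"
    by (intro R_diff R_mult_left R_const R_norm_diff_squared R_mono[OF inner_A_B_expansion]) simp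
  moreover have "\<forall>\<^sub>F x in F. 1 - cos (\<alpha> x)
      = 1/2 * (norm (U x - W x))\<^sup>2 - (A x \<bullet> B x - (1 - (norm (U x - W x))\<^sup>2 / 2))"
    using cos_alpha by eventually_elim simp
  ultimately have "(\<lambda>x. 1 - cos (\<alpha> x)) \<in> R 2"
    by (rule R_transfer)
  then show "(\<lambda>x. (\<alpha> x)\<^sup>2) \<in> R 2"
    using landau_o.big.compose[OF square_bigo_cos tendsto_alpha] unfolding R_def
    by (rule landau_o.big_trans[rotated])
qed

text \<open>Compare cos \<alpha> = 1 - \<alpha>^2/2 + O(\<rho>^4) with the expansion of A . B and
  double.\<close>

lemma alpha_squared_expansion: "(\<lambda>x. (\<alpha> x)\<^sup>2 - (norm (U x - W x))\<^sup>2) \<in> R 4"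
proof -
  have "(\<lambda>x. 2 * ((cos (\<alpha> x) - (1 - (\<alpha> x)\<^sup>2 / 2))
      - (A x \<bullet> B x - (1 - (norm (U x - W x))\<^sup>2 / 2)))) \<in> R 4"
    by (intro R_mult_left R_const R_diff cos_diff_R R_alpha inner_A_B_expansion)
  moreover have "\<forall>\<^sub>F x in F. (\<alpha> x)\<^sup>2 - (norm (U x - W x))\<^sup>2 = 2 * ((cos (\<alpha> x) - (1 - (\<alpha> x)\<^sup>2 / 2))
      - (A x \<bullet> B x - (1 - (norm (U x - W x))\<^sup>2 / 2)))"
    using cos_alpha by eventually_elim simp
  ultimately show ?thesis by (rule R_transfer)
qed

section \<open>Coefficients of U and W in the interpolated point\<close>

text \<open>sinc (s \<alpha>) / sinc \<alpha> = (1 - s^2 \<alpha>^2/6) (1 + \<alpha>^2/6) +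
  O(\<rho>^4) = 1 + (1 - s^2) \<alpha>^2/6 + O(\<rho>^4), after which \<alpha>^2 may be replaced by
  |U - W|^2.\<close>

lemma slerp_coeff_expansion:
  assumes "s \<in> R 0"
  shows "(\<lambda>x. slerp_coeff (s x) (\<alpha> x) - s x * (1 + (1 - (s x)\<^sup>2) * (norm (U x - W x))\<^sup>2 / 6)) \<in> R 4"
proof -
  have sa: "(\<lambda>x. s x * \<alpha> x) \<in> R 1"
    using R_mult_left[OF assms R_alpha] .
  have "(\<lambda>x. sinc (s x * \<alpha> x) * (1 / sinc (\<alpha> x))
      - (1 - (s x * \<alpha> x)\<^sup>2 / 6) * (1 + (\<alpha> x)\<^sup>2 / 6)) \<in> R 4"
    by (rule R_mult_diff[OF sinc_diff_R[OF sa] inverse_sinc_diff_R[OF R_alpha]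
          R_bounded_of_diff[OF inverse_sinc_diff_R[OF R_alpha] bounded_quadratic(1)[OF R_alpha]]
          bounded_quadratic(2)[OF sa]])
  \<comment> \<open>This cancels the quartic cross term of the two truncated factors.\<close>
  moreover have "(\<lambda>x. (- 1 / 36) * (s x)\<^sup>2 * (\<alpha> x) ^ 4) \<in> R 4"
    using R_power[OF R_alpha, of 4] by (intro R_mult_left R_const R_power_0 assms) simp
  moreover have "(\<lambda>x. (1/6) * (1 - (s x)\<^sup>2) * ((\<alpha> x)\<^sup>2 - (norm (U x - W x))\<^sup>2)) \<in> R 4"
    by (intro R_mult_left R_const R_diff R_power_0 assms alpha_squared_expansion)
  ultimately have *: "(\<lambda>x. s x * ((sinc (s x * \<alpha> x) * (1 / sinc (\<alpha> x))
      - (1 - (s x * \<alpha> x)\<^sup>2 / 6) * (1 + (\<alpha> x)\<^sup>2 / 6))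
      + (- 1 / 36) * (s x)\<^sup>2 * (\<alpha> x) ^ 4
      + (1/6) * (1 - (s x)\<^sup>2) * ((\<alpha> x)\<^sup>2 - (norm (U x - W x))\<^sup>2))) \<in> R 4"
    by (intro R_mult_left[OF assms] R_add)
  have "s' * (k - (1 - (s' * a)\<^sup>2 / 6) * (1 + a\<^sup>2 / 6) + (- 1 / 36) * s'\<^sup>2 * a ^ 4
      + (1/6) * (1 - s'\<^sup>2) * (a\<^sup>2 - d)) = s' * k - s' * (1 + (1 - s'\<^sup>2) * d / 6)" for s' k a d :: real
    by (simp add: field_simps power2_eq_square power4_eq_xxxx)
  from *[unfolded this] show ?thesis
    by (simp add: slerp_coeff_def)
qed

lemma R_mult_power:
  assumes "f \<in> R 2" "v \<in> R 1"
  shows "(\<lambda>x. f x * (v x)\<^sup>2) \<in> R 4"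
  using R_mult[OF assms(1) R_power[OF assms(2), of 2]] by simp

text \<open>General s and v cover both coefficients: s = 1 - t with v = |U|, and s = t with v =
  |W|.\<close>

lemma tangential_coeff_expansion:
  assumes "s \<in> R 0" "v \<in> R 1"
  shows "(\<lambda>x. slerp_coeff (s x) (\<alpha> x) * sinc (v x)
    - s x * (1 + ((1 - (s x)\<^sup>2) * (norm (U x - W x))\<^sup>2 - (v x)\<^sup>2) / 6)) \<in> R 4"
proof -
  let ?D = "\<lambda>x. (norm (U x - W x))\<^sup>2"
  have c: "(\<lambda>x. (1 - (s x)\<^sup>2) * ?D x) \<in> R 2"
    by (intro R_mult_left R_diff R_const R_power_0 assms R_norm_diff_squared)
  have "(\<lambda>x. s x * (1 + 1/6 * ((1 - (s x)\<^sup>2) * ?D x))) \<in> R 0"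
    by (intro R_mult_left R_add R_const assms R_bounded_of_R[OF c])
  then have "(\<lambda>x. s x * (1 + (1 - (s x)\<^sup>2) * ?D x / 6)) \<in> R 0"
    by simp
  then have "(\<lambda>x. slerp_coeff (s x) (\<alpha> x) * sinc (v x)
      - (s x * (1 + (1 - (s x)\<^sup>2) * ?D x / 6)) * (1 - (v x)\<^sup>2 / 6)) \<in> R 4"
    by (rule R_mult_diff[OF slerp_coeff_expansion[OF assms(1)] sinc_diff_R[OF assms(2)] bounded_sinc])
  moreover have "(\<lambda>x. (1 / 36) * (s x * ((1 - (s x)\<^sup>2) * ?D x * (v x)\<^sup>2))) \<in> R 4"
    by (intro R_mult_left R_const assms(1) R_mult_power c assms(2))
  ultimately have *: "(\<lambda>x. slerp_coeff (s x) (\<alpha> x) * sinc (v x)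
      - (s x * (1 + (1 - (s x)\<^sup>2) * ?D x / 6)) * (1 - (v x)\<^sup>2 / 6)
      - (1 / 36) * (s x * ((1 - (s x)\<^sup>2) * ?D x * (v x)\<^sup>2))) \<in> R 4"
    by (rule R_diff)
  show ?thesis
    by (rule R_transfer[OF *]) (simp add: field_simps)
qed

lemma correction_coeff_R:
  assumes "s \<in> R 0" "v \<in> R 1"
  shows "(\<lambda>x. s x * (((1 - (s x)\<^sup>2) * (norm (U x - W x))\<^sup>2 - (v x)\<^sup>2) / 6)) \<in> R 2"
proof -
  have "(\<lambda>x. s x * (1/6 * ((1 - (s x)\<^sup>2) * (norm (U x - W x))\<^sup>2 - (v x)\<^sup>2))) \<in> R 2"
    using R_power[OF assms(2), of 2]
    by (intro R_mult_left R_diff R_const R_power_0 assms(1) R_norm_diff_squared) simp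
  then show ?thesis by simp
qed

text \<open>This accuracy suffices for |P|^2, where the coefficients multiply quantities of order
  2.\<close>

lemma tangential_coeff_leading:
  assumes "s \<in> R 0" "v \<in> R 1"
  shows "(\<lambda>x. slerp_coeff (s x) (\<alpha> x) * sinc (v x) - s x) \<in> R 2"
proof (rule R_trans)
  show "(\<lambda>x. slerp_coeff (s x) (\<alpha> x) * sinc (v x)
    - s x * (1 + ((1 - (s x)\<^sup>2) * (norm (U x - W x))\<^sup>2 - (v x)\<^sup>2) / 6)) \<in> R 2"
    using tangential_coeff_expansion[OF assms] by (rule R_mono) simp
  show "(\<lambda>x. s x * (1 + ((1 - (s x)\<^sup>2) * (norm (U x - W x))\<^sup>2 - (v x)\<^sup>2) / 6) - s x) \<in> R 2"
    by (rule R_transfer[OF correction_coeff_R[OF assms]]) (simp add: distrib_left)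
qed

lemma R_1_minus_t: "(\<lambda>x. 1 - t x) \<in> R 0"
  by (intro R_diff R_const R_t)

section \<open>Tangential component of the interpolated point and its distance from y\<close>

definition p :: "'x \<Rightarrow> real" where "p x = slerp_coeff (1 - t x) (\<alpha> x) * sinc (norm (U x))"
definition q :: "'x \<Rightarrow> real" where "q x = slerp_coeff (t x) (\<alpha> x) * sinc (norm (W x))"
definition P :: "'x \<Rightarrow> real^3" where "P x = p x *\<^sub>R U x + q x *\<^sub>R W x"
definition r :: "'x \<Rightarrow> real" where "r x = arccos (y \<bullet> S x)"

lemma p_leading: "(\<lambda>x. p x - (1 - t x)) \<in> R 2" and q_leading: "(\<lambda>x. q x - t x) \<in> R 2"
  unfolding p_def q_def
  by (intro tangential_coeff_leading R_1_minus_t R_t R_U R_W)+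

lemma p_bounded: "p \<in> R 0" and q_bounded: "q \<in> R 0"
  using R_bounded_of_diff[OF p_leading R_1_minus_t] R_bounded_of_diff[OF q_leading R_t] by auto

lemma slerp_coeff_leading:
  assumes "s \<in> R 0"
  shows "(\<lambda>x. slerp_coeff (s x) (\<alpha> x) - s x) \<in> R 2"
  \<comment> \<open>Choosing v = 0 turns the factor \<open>sinc (v x)\<close> into 1.\<close>
  using tangential_coeff_leading[OF assms, of "\<lambda>_. 0"] by (simp add: R_def)

text \<open>Inserting the endpoint coordinates into the linear combination separates a multiple of y
  from P, because U and W are orthogonal to y.\<close>

lemma S_decomposition:
  "\<forall>\<^sub>F x in F. S x - (y \<bullet> S x) *\<^sub>R y = P x \<and>
    y \<bullet> S x = slerp_coeff (1 - t x) (\<alpha> x) * cos (norm (U x)) + slerp_coeff (t x) (\<alpha> x) * cos (norm (W x))"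
  using representation
proof eventually_elim
  case (elim x)
  let ?a = "slerp_coeff (1 - t x) (\<alpha> x)" and ?b = "slerp_coeff (t x) (\<alpha> x)"
  have 0: "y \<bullet> U x = 0" "y \<bullet> W x = 0"
    using elim by (auto simp: inner_commute)
  have eq: "S x = (?a * cos (norm (U x)) + ?b * cos (norm (W x))) *\<^sub>R y + P x"
  proof -
    have "S x = ?a *\<^sub>R A x + ?b *\<^sub>R B x"
      using elim by blast
    also have "A x = cos (norm (U x)) *\<^sub>R y + sinc (norm (U x)) *\<^sub>R U x"
      using elim by blast
    also have "B x = cos (norm (W x)) *\<^sub>R y + sinc (norm (W x)) *\<^sub>R W x"
      using elim by blast
    finally show ?thesis
      by (simp add: P_def p_def q_def algebra_simps)
  qed
  then have "y \<bullet> S x = ?a * cos (norm (U x)) + ?b * cos (norm (W x))"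
    using norm_y 0 by (simp add: P_def inner_simps dot_square_norm)
  with eq show ?case by simp
qed

lemma cos_minus_1_R:
  assumes "v \<in> R 1"
  shows "(\<lambda>x. cos (v x) - 1) \<in> R 2"
proof (rule R_trans)
  show "(\<lambda>x. cos (v x) - (1 - (v x)\<^sup>2 / 2)) \<in> R 2"
    using cos_diff_R[OF assms] by (rule R_mono) simp
  have *: "(\<lambda>x. - 1/2 * (v x)\<^sup>2) \<in> R 2"
    using R_power[OF assms, of 2] by (intro R_mult_left R_const) simp
  show "(\<lambda>x. (1 - (v x)\<^sup>2 / 2) - 1) \<in> R 2"
    by (rule R_transfer[OF *]) simp
qed

text \<open>\<open>t\<close> need not converge, so the two weights need not have limits. Instead the
  leading parts 1 - t and t of the coefficient of y add up to 1, with an error of order 2.\<close>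

lemma tendsto_inner_S: "((\<lambda>x. y \<bullet> S x) \<longlongrightarrow> 1) F"
proof -
  have "(\<lambda>x. (slerp_coeff (1 - t x) (\<alpha> x) * cos (norm (U x)) - (1 - t x) * 1)
      + (slerp_coeff (t x) (\<alpha> x) * cos (norm (W x)) - t x * 1)) \<in> R 2"
    by (intro R_add R_mult_diff slerp_coeff_leading cos_minus_1_R R_1_minus_t R_t R_U R_W bounded_cos)
  then have "(\<lambda>x. y \<bullet> S x - 1) \<in> R 2"
    by (rule R_transfer) (use S_decomposition in eventually_elim, simp)
  then have "((\<lambda>x. y \<bullet> S x - 1) \<longlongrightarrow> 0) F"
    by (intro R_tendsto_0) (rule R_mono, auto)
  then show ?thesis by (rule LIM_zero_cancel)
qed

text \<open>Eventually y . S > 0, whereas y . (- y) = -1.\<close>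

lemma eventually_S_not_antipodal: "\<forall>\<^sub>F x in F. S x \<noteq> - y"
proof -
  have "\<forall>\<^sub>F x in F. 0 < y \<bullet> S x"
    using tendsto_inner_S by (rule order_tendstoD) simp
  then show ?thesis
    by eventually_elim (auto simp: dot_square_norm norm_y)
qed

lemma unit_S: "\<forall>\<^sub>F x in F. norm (S x) = 1"
  using unit_A unit_B by eventually_elim (simp add: S_def norm_slerp)

lemma tendsto_r: "(r \<longlongrightarrow> 0) F"
  unfolding r_def[abs_def]
proof (rule tendsto_arccos_at_1[OF tendsto_inner_S])
  show "\<forall>\<^sub>F x in F. y \<bullet> S x \<in> {-1..1}"
    using unit_S by eventually_elim (simp add: inner_unit_bounds norm_y)
qed

lemma Log_S: "\<forall>\<^sub>F x in F. Log_sphere y (S x) = (1 / sinc (r x)) *\<^sub>R P x \<and> norm (P x) = sin (r x)"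
  using unit_S S_decomposition
proof eventually_elim
  case (elim x)
  then have "norm (S x) = 1" "P x = S x - (y \<bullet> S x) *\<^sub>R y" by metis+
  then show ?case
    using Log_sphere_sinc[OF norm_y, of "S x"] norm_tangential_part[OF norm_y, of "S x"]
    by (simp add: r_def)
qed

lemma norm_comb_squared:
  "(norm (a *\<^sub>R U x + b *\<^sub>R W x))\<^sup>2
    = a * a * (norm (U x))\<^sup>2 + 2 * (a * b * (U x \<bullet> W x)) + b * b * (norm (W x))\<^sup>2"
  by (simp add: power2_norm_eq_inner inner_simps inner_commute algebra_simps)

lemma R_comb_squared:
  assumes "f \<in> R m" "g \<in> R m" "h \<in> R m"
  shows "(\<lambda>x. f x * (norm (U x))\<^sup>2 + 2 * (g x * (U x \<bullet> W x)) + h x * (norm (W x))\<^sup>2) \<in> R (m + 2)"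
  using R_mult[OF assms(1) R_power[OF R_U, of 2]] R_mult[OF assms(2) R_inner_U_W]
    R_mult[OF assms(3) R_power[OF R_W, of 2]]
  by (intro R_add[OF R_add] R_mult_left[OF R_const]) (simp_all add: numeral_2_eq_2)

text \<open>Both sides are quadratic forms in U and W whose coefficients, such as p^2 and (1 - t)^2,
  differ by order 2; the monomials in U and W add another 2.\<close>

lemma P_squared_expansion: "(\<lambda>x. (norm (P x))\<^sup>2 - (norm (Z x))\<^sup>2) \<in> R 4"
proof -
  have *: "(\<lambda>x. (p x * p x - (1 - t x) * (1 - t x)) * (norm (U x))\<^sup>2
      + 2 * ((p x * q x - (1 - t x) * t x) * (U x \<bullet> W x))
      + (q x * q x - t x * t x) * (norm (W x))\<^sup>2) \<in> R (2 + 2)"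
    by (intro R_comb_squared R_mult_diff p_leading q_leading p_bounded q_bounded R_1_minus_t R_t)
  then have "(\<lambda>x. (norm (P x))\<^sup>2 - (norm (Z x))\<^sup>2) \<in> R (2 + 2)"
    by (rule R_transfer, unfold P_def Z_def norm_comb_squared) (simp add: algebra_simps)
  then show ?thesis by simp
qed

lemma P_squared_R: "(\<lambda>x. (norm (P x))\<^sup>2) \<in> R 2"
proof -
  have "(\<lambda>x. (norm (P x))\<^sup>2) \<in> R (0 + 2)"
    unfolding P_def norm_comb_squared
    by (intro R_comb_squared R_mult_left p_bounded q_bounded)
  then show ?thesis by (simp only: add_0)
qed

lemma Z_squared_R: "(\<lambda>x. (norm (Z x))\<^sup>2) \<in> R 2"
proof -
  have "(\<lambda>x. (norm (Z x))\<^sup>2) \<in> R (0 + 2)"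
    unfolding Z_def norm_comb_squared
    by (intro R_comb_squared R_mult_left R_1_minus_t R_t)
  then show ?thesis by (simp only: add_0)
qed

text \<open>r^2 is O(sin^2 r), and sin^2 r = |P|^2 has order 2.\<close>

lemma R_r: "r \<in> R 1"
proof (rule R_sqrt)
  have "(\<lambda>x. (sin (r x))\<^sup>2) \<in> R 2"
    by (rule R_transfer[OF P_squared_R]) (use Log_S in eventually_elim, simp)
  then show "(\<lambda>x. (r x)\<^sup>2) \<in> R 2"
    using landau_o.big.compose[OF square_bigo_sin tendsto_r] unfolding R_def
    by (rule landau_o.big_trans[rotated])
qed

text \<open>In 1 + r^2/6 the term r^2 is replaced first by sin^2 r = |P|^2 and then by |Z|^2, each
  time at a cost of order 4.\<close>

lemma inverse_sinc_r_expansion: "(\<lambda>x. 1 / sinc (r x) - (1 + (norm (Z x))\<^sup>2 / 6)) \<in> R 4"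
proof -
  have "(\<lambda>x. (sin (r x))\<^sup>2 - (r x)\<^sup>2) \<in> R 4"
    using R_power[OF R_r, of 4] by (intro R_compose_power[OF sin_squared_expansion tendsto_r]) simp
  then have "(\<lambda>x. 1 / sinc (r x) - (1 + (r x)\<^sup>2 / 6) - 1/6 * ((sin (r x))\<^sup>2 - (r x)\<^sup>2)
      + 1/6 * ((norm (P x))\<^sup>2 - (norm (Z x))\<^sup>2)) \<in> R 4"
    by (intro R_add[OF R_diff[OF inverse_sinc_diff_R[OF R_r] R_mult_left[OF R_const]]]
        R_mult_left[OF R_const] P_squared_expansion)
  then show ?thesis
    by (rule R_transfer) (use Log_S in eventually_elim, simp add: field_simps)
qed

section \<open>The cubic correction\<close>

text \<open>The factor 1 + |Z|^2/6 of the logarithm multiplies the tangential coefficient; up to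
  order 4 the quadratic corrections simply add.\<close>

lemma Log_coeff_expansion:
  assumes "s \<in> R 0" "v \<in> R 1"
  shows "(\<lambda>x. 1 / sinc (r x) * (slerp_coeff (s x) (\<alpha> x) * sinc (v x))
    - (s x + (s x * (norm (Z x))\<^sup>2 + s x * (1 - (s x)\<^sup>2) * (norm (U x - W x))\<^sup>2 - s x * (v x)\<^sup>2) / 6))
    \<in> R 4"
proof -
  let ?c = "\<lambda>x. s x * (((1 - (s x)\<^sup>2) * (norm (U x - W x))\<^sup>2 - (v x)\<^sup>2) / 6)"
  let ?k = "\<lambda>x. slerp_coeff (s x) (\<alpha> x) * sinc (v x)"
  have k: "?k \<in> R 0"
    using tangential_coeff_leading[OF assms] assms(1) by (rule R_bounded_of_diff)
  have "(\<lambda>x. 1 + 1/6 * (norm (Z x))\<^sup>2) \<in> R 0"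
    by (intro R_add R_const R_mult_left R_bounded_of_R[OF Z_squared_R])
  then have z: "(\<lambda>x. 1 + (norm (Z x))\<^sup>2 / 6) \<in> R 0"
    by simp
  \<comment> \<open>The discarded cross term is a product of two corrections of order 2.\<close>
  have "(\<lambda>x. 1/6 * ((norm (Z x))\<^sup>2 * ?c x)) \<in> R 4"
    using R_mult[OF Z_squared_R correction_coeff_R[OF assms]] by (intro R_mult_left[OF R_const]) simp
  with R_mult_diff[OF inverse_sinc_r_expansion tangential_coeff_expansion[OF assms] k z]
  have *: "(\<lambda>x. (1 / sinc (r x) * ?k x - (1 + (norm (Z x))\<^sup>2 / 6)
      * (s x * (1 + ((1 - (s x)\<^sup>2) * (norm (U x - W x))\<^sup>2 - (v x)\<^sup>2) / 6)))
      + 1/6 * ((norm (Z x))\<^sup>2 * ?c x)) \<in> R 4"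
    by (rule R_add)
  have "l * k - (1 + z / 6) * (s' * (1 + (a * d - v') / 6)) + 1/6 * (z * (s' * ((a * d - v') / 6)))
      = l * k - (s' + (s' * z + s' * a * d - s' * v') / 6)" for l k z d s' a v' :: real
    by (simp add: field_simps)
  from *[unfolded this] show ?thesis .
qed

text \<open>Coefficient errors of order 4 multiply U and W, which have order 1; hence order
  5.\<close>

lemma Log_slerp_expansion:
  "(\<lambda>x. norm (Log_sphere y (S x) - (Z x + slerp_correction (t x) (U x) (W x)))) \<in> R 5"
proof -
  let ?e = "\<lambda>x. 1 / sinc (r x) * p x
    - ((1 - t x) + ((1 - t x) * (norm (Z x))\<^sup>2
        + (1 - t x) * (1 - (1 - t x)\<^sup>2) * (norm (U x - W x))\<^sup>2 - (1 - t x) * (norm (U x))\<^sup>2) / 6)"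
  let ?f = "\<lambda>x. 1 / sinc (r x) * q x
    - (t x + (t x * (norm (Z x))\<^sup>2
        + t x * (1 - (t x)\<^sup>2) * (norm (U x - W x))\<^sup>2 - t x * (norm (W x))\<^sup>2) / 6)"
  have "?e \<in> R 4"
    unfolding p_def by (rule Log_coeff_expansion[OF R_1_minus_t R_U])
  moreover have "?f \<in> R 4"
    unfolding q_def by (rule Log_coeff_expansion[OF R_t R_W])
  ultimately have ef: "(\<lambda>x. \<bar>?e x\<bar> * norm (U x) + \<bar>?f x\<bar> * norm (W x)) \<in> R 5"
    using R_mult[of "\<lambda>x. \<bar>?e x\<bar>" 4 _ 1, OF _ R_U] R_mult[of "\<lambda>x. \<bar>?f x\<bar>" 4 _ 1, OF _ R_W]
    by (intro R_add) (simp_all add: R_def)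
  have "(\<lambda>x. norm (?e x *\<^sub>R U x + ?f x *\<^sub>R W x)) \<in> R 5"
    by (rule R_of_norm_le[OF ef]) (simp, rule norm_triangle_le, simp)
  moreover have "\<forall>\<^sub>F x in F. norm (Log_sphere y (S x) - (Z x + slerp_correction (t x) (U x) (W x)))
      = norm (?e x *\<^sub>R U x + ?f x *\<^sub>R W x)"
    using Log_S
  proof eventually_elim
    case (elim x)
    have 1: "Log_sphere y (S x) = (1 / sinc (r x) * p x) *\<^sub>R U x + (1 / sinc (r x) * q x) *\<^sub>R W x"
      using elim by (simp add: P_def scaleR_add_right)
    have c: "slerp_correction (t x) (U x) (W x) = (1/6) *\<^sub>R ((norm (Z x))\<^sup>2 *\<^sub>R Z x
         + ((1 - t x) * t x * (2 - t x) * (norm (U x - W x))\<^sup>2) *\<^sub>R U x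
         + (t x * (1 - (t x)\<^sup>2) * (norm (U x - W x))\<^sup>2) *\<^sub>R W x
         - ((1 - t x) * (norm (U x))\<^sup>2) *\<^sub>R U x
         - (t x * (norm (W x))\<^sup>2) *\<^sub>R W x)"
      by (simp add: slerp_correction_def Let_def Z_def)
    define z d where "z = (norm (Z x))\<^sup>2" and "d = (norm (U x - W x))\<^sup>2"
    have "Z x + slerp_correction (t x) (U x) (W x)
        = ((1 - t x) + ((1 - t x) * z + (1 - t x) * t x * (2 - t x) * d - (1 - t x) * (norm (U x))\<^sup>2) / 6) *\<^sub>R U x
        + (t x + (t x * z + t x * (1 - (t x)\<^sup>2) * d - t x * (norm (W x))\<^sup>2) / 6) *\<^sub>R W x"
      unfolding c z_def[symmetric] d_def[symmetric] unfolding Z_def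
      by (simp add: vec_eq_iff field_simps)
    \<comment> \<open>Reconciles the weight of U in \<open>slerp_correction\<close> with s (1 - s^2)
      at s = 1 - t.\<close>
    moreover have "(1 - t x) * t x * (2 - t x) = (1 - t x) * (1 - (1 - t x)\<^sup>2)"
      by (simp add: power2_eq_square algebra_simps)
    ultimately have "Z x + slerp_correction (t x) (U x) (W x)
        = ((1 - t x) + ((1 - t x) * z + (1 - t x) * (1 - (1 - t x)\<^sup>2) * d - (1 - t x) * (norm (U x))\<^sup>2) / 6) *\<^sub>R U x
        + (t x + (t x * z + t x * (1 - (t x)\<^sup>2) * d - t x * (norm (W x))\<^sup>2) / 6) *\<^sub>R W x"
      by (simp only:)
    then have "Log_sphere y (S x) - (Z x + slerp_correction (t x) (U x) (W x))
        = ?e x *\<^sub>R U x + ?f x *\<^sub>R W x"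
      unfolding 1 z_def d_def by (simp only: scaleR_diff_left add_diff_add)
    then show ?case by simp
  qed
  ultimately show ?thesis by (rule R_transfer)
qed

end

section \<open>Non-antipodal neighbourhoods, algebra of the correction, and the uniform
  estimate\<close>

text \<open>Antipodal unit vectors are at distance 2, but the path through y is shorter than
  2.\<close>

lemma not_antipodal_if_close:
  fixes a b y :: "'a::real_normed_vector"
  assumes "norm a = 1" "dist a y < 1" "dist b y < 1"
  shows "a \<noteq> - b"
proof
  assume "a = - b"
  then have "a - b = 2 *\<^sub>R a"
    by (simp add: scaleR_2)
  then have "dist a b = 2"
    using assms(1) by (simp add: dist_norm)
  then show False
    using dist_triangle2[of a b y] assms(2,3) by simp
qed

text \<open>Z and U - W depend linearly on the pair (U, W), so each term is the squared norm of one
  linear map times another linear map. Polarizing the squared norm gives the trilinear map.\<close>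

lemma homogeneous_cubic_slerp_correction:
  "homogeneous_cubic (\<lambda>(U, W). slerp_correction t U W)"
proof -
  define z d :: "(real^3) \<times> (real^3) \<Rightarrow> real^3"
    where "z v = (1 - t) *\<^sub>R fst v + t *\<^sub>R snd v" and "d v = fst v - snd v" for v
  define M where "M v w x = (1/6) *\<^sub>R
      ((z v \<bullet> z w) *\<^sub>R z x + ((1 - t) * t * (2 - t) * (d v \<bullet> d w)) *\<^sub>R fst x
       + (t * (1 - t\<^sup>2) * (d v \<bullet> d w)) *\<^sub>R snd x
       - ((1 - t) * (fst v \<bullet> fst w)) *\<^sub>R fst x - (t * (snd v \<bullet> snd w)) *\<^sub>R snd x)" for v w x
  have z: "z (v + w) = z v + z w" "z (c *\<^sub>R v) = c *\<^sub>R z v" for v w c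
    by (simp_all add: z_def algebra_simps)
  have d: "d (v + w) = d v + d w" "d (c *\<^sub>R v) = c *\<^sub>R d v" for v w c
    by (simp_all add: d_def algebra_simps)
  have "linear (\<lambda>v. M v w x)" "linear (\<lambda>w. M v w x)" "linear (\<lambda>x. M v w x)" for v w x
    by (rule linearI; simp add: M_def z d inner_simps algebra_simps)+
  moreover have "(case v of (U, W) \<Rightarrow> slerp_correction t U W) = M v v v" for v
    by (cases v) (simp add: slerp_correction_def M_def z_def d_def Let_def power2_norm_eq_inner)
  ultimately show ?thesis
    unfolding homogeneous_cubic_def by blast
qed

text \<open>At t = 0 and t = 1 the interpolation returns an endpoint and the correction vanishes.
  Otherwise two orthogonal tangent vectors of equal length give a nonzero component along U.\<close>

lemma slerp_correction_nonzero:
  assumes "norm y = 1" "t \<noteq> 0" "t \<noteq> 1"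
  shows "\<exists>U\<in>tangent_space y. \<exists>W\<in>tangent_space y. slerp_correction t U W \<noteq> 0"
proof -
  obtain U where U: "U \<noteq> 0" "orthogonal y U"
    using orthogonal_to_vector_exists[of y] by auto
  \<comment> \<open>The cross product with the unit vector y rotates U by a right angle inside the
    tangent plane.\<close>
  define W where "W = cross3 y U"
  have yU: "y \<bullet> U = 0" "U \<bullet> y = 0"
    using U by (simp_all add: orthogonal_def inner_commute)
  have W: "W \<bullet> y = 0" "U \<bullet> W = 0" "W \<bullet> U = 0"
    by (simp_all add: W_def dot_cross_self)
  have nW: "(norm W)\<^sup>2 = (norm U)\<^sup>2"
    using norm_cross_dot[of y U] yU assms(1) by (simp add: W_def)
  have nd: "(norm (U - W))\<^sup>2 = 2 * (norm U)\<^sup>2"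
    using W nW by (simp add: power2_norm_eq_inner inner_simps)
  have nz: "(norm ((1 - t) *\<^sub>R U + t *\<^sub>R W))\<^sup>2 = ((1 - t)\<^sup>2 + t\<^sup>2) * (norm U)\<^sup>2"
    using W nW unfolding power2_norm_eq_inner
    by (simp add: inner_simps power2_eq_square) (simp add: algebra_simps)
  \<comment> \<open>After taking out 1 - t, the bracket (1 - t)^2 + t^2 + 2 t (2 - t) - 1 collapses
    to 2 t.\<close>
  have "6 * (slerp_correction t U W \<bullet> U) = 2 * t * (1 - t) * ((norm U)\<^sup>2 * (norm U)\<^sup>2)"
    unfolding slerp_correction_def Let_def nd nz
    by (simp add: inner_simps W nW flip: power2_norm_eq_inner) (simp add: power2_eq_square power4_eq_xxxx algebra_simps)
  then have "slerp_correction t U W \<noteq> 0"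
    using U assms by auto
  then show ?thesis
    using yU W by (auto simp: tangent_space_def)
qed

theorem lemma1:
  fixes y :: "real^3" and I :: "real set"
  assumes "y \<in> sphere 0 1" and "is_interval I" and "bounded I"
  shows "(\<exists>\<delta>>0. \<exists>C. \<forall>A\<in>sphere 0 1. \<forall>B\<in>sphere 0 1.
            dist A y < \<delta> \<longrightarrow> dist B y < \<delta> \<longrightarrow>
              A \<noteq> - y \<and> B \<noteq> - y \<and> A \<noteq> - B \<and>
              (\<forall>t\<in>I. slerp A B t \<noteq> - y \<and>
                (let U = Log_sphere y A; W = Log_sphere y B; \<rho> = norm U + norm W in
                  norm (Log_sphere y (slerp A B t)
                        - ((1 - t) *\<^sub>R U + t *\<^sub>R W + slerp_correction t U W)) \<le> C * \<rho> ^ 5)))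
       \<and> (\<forall>t\<in>I. homogeneous_cubic (\<lambda>(U, W). slerp_correction t U W) \<and>
            (t \<noteq> 0 \<and> t \<noteq> 1 \<longrightarrow>
              (\<exists>U\<in>tangent_space y. \<exists>W\<in>tangent_space y. slerp_correction t U W \<noteq> 0)))"
proof -
  have y: "norm y = 1"
    using assms(1) by simp
  \<comment> \<open>With \<open>principal I\<close> for the parameter, what holds eventually holds
    for A, B near y and every t in I at once. The intersection confines A and B to the
    sphere.\<close>
  define F where "F = inf (nhds y \<times>\<^sub>F (nhds y \<times>\<^sub>F principal I))
    (principal (sphere 0 1 \<times> sphere 0 1 \<times> UNIV))"
  have le: "F \<le> nhds y \<times>\<^sub>F (nhds y \<times>\<^sub>F principal I)"
    by (simp add: F_def)
  have sphere: "\<forall>\<^sub>F x in F. x \<in> sphere 0 1 \<times> sphere 0 1 \<times> UNIV"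
    by (simp add: F_def eventually_inf_principal)
  interpret slerp_limit F y fst "\<lambda>x. fst (snd x)" "\<lambda>x. snd (snd x)"
  proof
    show "norm y = 1" by fact
    show "\<forall>\<^sub>F x in F. norm (fst x) = 1" "\<forall>\<^sub>F x in F. norm (fst (snd x)) = 1"
      using sphere by (eventually_elim, auto)+
    show "(fst \<longlongrightarrow> y) F"
      by (rule filterlim_mono[OF filterlim_fst order_refl le])
    show "((\<lambda>x. fst (snd x)) \<longlongrightarrow> y) F"
      by (rule filterlim_mono[OF filterlim_compose[OF filterlim_fst filterlim_snd] order_refl le])
    obtain c where c: "\<And>s. s \<in> I \<Longrightarrow> \<bar>s\<bar> \<le> c"
      using assms(3) by (auto simp: bounded_iff)
    have "filterlim (\<lambda>x. snd (snd x)) (principal I) F"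
      by (rule filterlim_mono[OF filterlim_compose[OF filterlim_snd filterlim_snd] order_refl le])
    then have "\<forall>\<^sub>F x in F. snd (snd x) \<in> I"
      by (simp add: filterlim_principal)
    then show "(\<lambda>x. snd (snd x)) \<in> O[F](\<lambda>_. 1)"
      by (intro bigoI[of _ c]) (auto elim!: eventually_mono simp: c)
  qed
  obtain C where C: "\<forall>\<^sub>F x in F. norm (Log_sphere y (S x)
      - (Z x + slerp_correction (snd (snd x)) (U x) (W x))) \<le> C * \<rho> x ^ 5"
    using Log_slerp_expansion unfolding R_def
    by (auto elim!: landau_o.bigE simp: abs_of_nonneg rho_nonneg)
  define Q where "Q x \<longleftrightarrow> S x \<noteq> - y
      \<and> norm (Log_sphere y (S x) - (Z x + slerp_correction (snd (snd x)) (U x) (W x))) \<le> C * \<rho> x ^ 5" for x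
  have "\<forall>\<^sub>F x in F. Q x"
    using C eventually_S_not_antipodal unfolding Q_def by eventually_elim simp
  \<comment> \<open>Unfolding the product filter yields neighbourhoods of y that do not depend on
    the parameter, as \<open>P3\<close> holds on all of \<open>I\<close>.\<close>
  then obtain P1 P2 P3 where P: "eventually P1 (nhds y)" "eventually P2 (nhds y)"
      "\<And>s. s \<in> I \<Longrightarrow> P3 s"
      "\<And>A B s. P1 A \<Longrightarrow> P2 B \<Longrightarrow> P3 s \<Longrightarrow> A \<in> sphere 0 1 \<Longrightarrow> B \<in> sphere 0 1 \<Longrightarrow> Q (A, B, s)"
    unfolding F_def eventually_inf_principal eventually_prod_filter eventually_principal
    by (smt (verit) SigmaI UNIV_I)
  then obtain \<epsilon> where \<epsilon>: "\<epsilon> > 0" "\<And>A. dist A y < \<epsilon> \<Longrightarrow> P1 A \<and> P2 A"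
    using eventually_conj[OF P(1,2)] unfolding eventually_nhds_metric by auto
  \<comment> \<open>Radius 1 is what \<open>not_antipodal_if_close\<close> requires.\<close>
  define \<delta> where "\<delta> = min \<epsilon> 1"
  then have \<delta>: "\<delta> > 0" "\<delta> \<le> \<epsilon>" "\<delta> \<le> 1"
    using \<epsilon>(1) by auto
  have Q: "Q (A, B, s)" if "A \<in> sphere 0 1" "B \<in> sphere 0 1" "dist A y < \<delta>" "dist B y < \<delta>" "s \<in> I" for A B s
    using that \<delta>(2) by (intro P(4)) (auto intro: P(3) simp: \<epsilon>(2))
  show ?thesis
  proof ((rule conjI, rule exI[of _ \<delta>], rule conjI[OF \<delta>(1)], rule exI[of _ C]);
      intro ballI impI conjI)
    fix A B :: "real^3"
    assume AB: "A \<in> sphere 0 1" "B \<in> sphere 0 1" "dist A y < \<delta>" "dist B y < \<delta>"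
    note Q = Q[OF this]
    show "A \<noteq> - y" "B \<noteq> - y" "A \<noteq> - B"
      using AB \<delta>(3) not_antipodal_if_close[of A y y] not_antipodal_if_close[of B y y]
        not_antipodal_if_close[of A y B] by simp_all
    fix s assume "s \<in> I"
    then show "slerp A B s \<noteq> - y"
      "let U = Log_sphere y A; W = Log_sphere y B; \<rho> = norm U + norm W in
        norm (Log_sphere y (slerp A B s) - ((1 - s) *\<^sub>R U + s *\<^sub>R W + slerp_correction s U W)) \<le> C * \<rho> ^ 5"
      using Q unfolding Q_def S_def Z_def U_def W_def \<rho>_def by auto
  next
    fix s assume "s \<in> I"
    show "homogeneous_cubic (\<lambda>(U, W). slerp_correction s U W)"
      by (rule homogeneous_cubic_slerp_correction)
    assume "s \<noteq> 0 \<and> s \<noteq> 1"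
    then show "\<exists>U\<in>tangent_space y. \<exists>W\<in>tangent_space y. slerp_correction s U W \<noteq> 0"
      using slerp_correction_nonzero[OF y] by simp
  qed
qed

end
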